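(* Let $n$ be a positive integer and let $S\subset\{1,\dots,n\}$ be a symmetric set of representatives mod $n$. Put $x=z^{1/2}-z^{-1/2}$, where $z=e^{2\pi i\sigma}$ and $z^{1/2}=e^{\pi i\sigma}$, and let $|q|<1$. (1) If $n\notin S$, write $S=\{\ell_1,\dots,\ell_s\}$. Then \[\sum_{k=0}^\infty B_{S,n,k}(q)\,x^{2k}=\prod_{j=1}^s\frac{\vartheta_{\alpha(n,\ell_j)}(q^n,z)}{\widetilde\vartheta_{\alpha(n,\ell_j)}(q^n)}.\] (2) If $n\in S$, write $S=\{n=\ell_0,\ell_1,\dots,\ell_s\}$. Then \[\sqrt{1+\big(\tfrac{x}{2}\big)^2}\,\sum_{k=0}^\infty B_{S,n,k}(q)\,x^{2k}=\frac{\prod_{j=0}^s\vartheta_{\alpha(n,\ell_j)}(q^n,z)}{\prod_{j=0}^s\widetilde\vartheta_{\alpha(n,\ell_j)}(q^n)}.\]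
   Context: A set $S\subset\{1,\dots,n\}$ is a symmetric set of representatives mod $n$ if for every $\ell\in S$, some element of $S$ is congruent to $-\ell$ mod $n$; "$m\in S\pmod n$" means $m$ is congruent mod $n$ to some element of $S$. Define \[B_{S,n,k}(q)=\sum_{\substack{0<m_1<\cdots<m_k\\ m_i\in S \pmod n}}\frac{q^{m_1+\cdots+m_k}}{(1+q^{m_1})^2\cdots(1+q^{m_k})^2},\] with $B_{S,n,0}=1$. For $1\le\ell\le n$, $\alpha(n,\ell)=\frac{\ell}{n}-\frac12$. For $r\in\mathbb{Q}$, with $q=e^{2\pi i\tau}$, $z=e^{2\pi i\sigma}$, $\vartheta_r(q,z)=\sum_{m\in\mathbb{Z}+r}q^{\frac12m^2}z^m$ (where $z^m=e^{2\pi i m\sigma}$), and $\widetilde\vartheta_r(q)=\vartheta_r(q,1)=\sum_{m\in\mathbb{Z}+r}q^{\frac12m^2}$. *)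

theory Defs
  imports "HOL-Analysis.Analysis" "HOL-Number_Theory.Cong"
begin

definition symmetric_reps :: "nat \<Rightarrow> nat set \<Rightarrow> bool" where
  "symmetric_reps n S \<longleftrightarrow>
     S \<subseteq> {1..n} \<and> (\<forall>l\<in>S. \<exists>l'\<in>S. [int l' = - int l] (mod int n))"

definition in_mod :: "nat \<Rightarrow> nat set \<Rightarrow> nat \<Rightarrow> bool" where
  "in_mod m S n \<longleftrightarrow> (\<exists>l\<in>S. [m = l] (mod n))"

text \<open>
  The index set consists of the strictly increasing tuples \<open>0 < m\<^sub>1 < \<dots> < m\<^sub>k\<close>,
  encoded as lists. For \<open>k = 0\<close> it is \<open>{[]}\<close>, so that the value is 1.
\<close>

definition B :: "nat set \<Rightarrow> nat \<Rightarrow> nat \<Rightarrow> complex \<Rightarrow> complex" where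
  "B S n k q =
     (\<Sum>\<^sub>\<infinity>ms\<in>{ms. length ms = k \<and> sorted_wrt (<) ms \<and> (\<forall>m\<in>set ms. 0 < m \<and> in_mod m S n)}.
        q ^ sum_list ms / (\<Prod>m\<leftarrow>ms. (1 + q ^ m)\<^sup>2))"

definition alpha :: "nat \<Rightarrow> nat \<Rightarrow> rat" where
  "alpha n l = of_nat l / of_nat n - 1 / 2"

text \<open>
  Fractional powers of \<open>q = exp (2\<pi>i\<tau>)\<close> and \<open>z = exp (2\<pi>i\<sigma>)\<close> depend on \<open>\<tau>\<close> and \<open>\<sigma>\<close>,
  so these are the arguments: \<open>theta r \<tau> \<sigma>\<close> is \<open>\<vartheta>\<^sub>r(q, z)\<close>, where
  \<open>q\<close> to the power \<open>m\<^sup>2/2\<close> is \<open>exp (\<pi>i\<tau>m\<^sup>2)\<close>. Passing from \<open>q\<close> to its \<open>n\<close>-th power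
  replaces \<open>\<tau>\<close> by \<open>n\<tau>\<close>, and \<open>z = 1\<close> means \<open>\<sigma> = 0\<close>.
\<close>

definition theta :: "rat \<Rightarrow> complex \<Rightarrow> complex \<Rightarrow> complex" where
  "theta r \<tau> \<sigma> =
     (\<Sum>\<^sub>\<infinity>m\<in>{of_int j + r |j::int. True}.
        exp (pi * \<i> * \<tau> * (of_rat m)\<^sup>2) * exp (2 * pi * \<i> * of_rat m * \<sigma>))"

definition theta0 :: "rat \<Rightarrow> complex \<Rightarrow> complex" where
  "theta0 r \<tau> = theta r \<tau> 0"

text \<open>\<open>xvar \<sigma>\<close> is \<open>x = z\<^sup>1\<^sup>/\<^sup>2 - z\<^sup>-\<^sup>1\<^sup>/\<^sup>2\<close> with \<open>z\<^sup>1\<^sup>/\<^sup>2 = exp (\<pi>i\<sigma>)\<close>.\<close>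

definition xvar :: "complex \<Rightarrow> complex" where
  "xvar \<sigma> = exp (pi * \<i> * \<sigma>) - exp (- (pi * \<i> * \<sigma>))"

text \<open>
  The square root of \<open>1 + (x/2)\<^sup>2\<close> is the analytic function of \<open>\<sigma>\<close> with value 1 at
  \<open>\<sigma> = 0\<close>, on any domain \<open>D\<close> containing 0. The lemmas
  \<open>sqrt_branch_on_csqrt\<close> and \<open>sqrt_branch_on_UNIV\<close> show that this branch is the principal square root for \<open>\<bar>Re \<sigma>\<bar> < 1/2\<close>, and that it extends
  to the whole plane. It is not the principal square root everywhere: at \<open>\<sigma> = 1\<close> it is -1.
\<close>

definition sqrt_branch_on :: "complex set \<Rightarrow> (complex \<Rightarrow> complex) \<Rightarrow> bool" where
  "sqrt_branch_on D w \<longleftrightarrow>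
     open D \<and> connected D \<and> 0 \<in> D \<and> w holomorphic_on D \<and> w 0 = 1 \<and>
     (\<forall>\<sigma>\<in>D. (w \<sigma>)\<^sup>2 = 1 + (xvar \<sigma> / 2)\<^sup>2)"

lemma xvar_cos:
  fixes \<sigma> :: complex
  shows "1 + (xvar \<sigma> / 2)\<^sup>2 = (cos (pi * \<sigma>))\<^sup>2"
proof -
  have "xvar \<sigma> / 2 = \<i> * sin (pi * \<sigma>)"
    by (simp add: xvar_def sin_exp_eq field_simps)
  then show ?thesis
    by (simp add: power_mult_distrib cos_squared_eq)
qed

lemma sqrt_branch_on_UNIV: "sqrt_branch_on UNIV (\<lambda>\<sigma>. cos (pi * \<sigma>))"
  by (auto simp: sqrt_branch_on_def xvar_cos intro!: holomorphic_intros)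

lemma sqrt_branch_on_csqrt:
  "sqrt_branch_on {\<sigma>. \<bar>Re \<sigma>\<bar> < 1 / 2} (\<lambda>\<sigma>. csqrt (1 + (xvar \<sigma> / 2)\<^sup>2))"
proof -
  let ?D = "{\<sigma>. \<bar>Re \<sigma>\<bar> < 1 / 2}"
  have D: "?D = {\<sigma>. Re \<sigma> < 1 / 2} \<inter> {\<sigma>. Re \<sigma> > - (1 / 2)}"
    by auto
  have dom: "convex ?D" "open ?D"
    unfolding D by (intro convex_Int open_Int convex_halfspace_Re_lt convex_halfspace_Re_gt
        open_halfspace_Re_lt open_halfspace_Re_gt)+
  have eq: "csqrt (1 + (xvar \<sigma> / 2)\<^sup>2) = cos (pi * \<sigma>)"
    if "\<sigma> \<in> ?D" for \<sigma> :: complex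
  proof -
    from that have "- (1 / 2) < Re \<sigma>" "Re \<sigma> < 1 / 2"
      by auto
    then have "pi * - (1 / 2) < pi * Re \<sigma>" "pi * Re \<sigma> < pi * (1 / 2)"
      by (simp_all only: mult_less_cancel_left_pos pi_gt_zero)
    then have "cos (pi * Re \<sigma>) > 0"
      by (intro cos_gt_zero_pi) auto
    then have "Re (cos (pi * \<sigma>)) > 0"
      by (simp add: Re_cos add_pos_pos)
    then show ?thesis
      unfolding xvar_cos by (intro csqrt_square) auto
  qed
  have hol: "(\<lambda>\<sigma>. csqrt (1 + (xvar \<sigma> / 2)\<^sup>2)) holomorphic_on ?D"
    by (subst holomorphic_cong[OF refl eq]) (auto intro!: holomorphic_intros)
  show ?thesis
    unfolding sqrt_branch_on_def
    using dom hol by (intro conjI ballI power2_csqrt) (simp_all add: convex_connected xvar_def)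
qed

end

theory Submission
  imports Defs "HOL-Complex_Analysis.Conformal_Mappings"
begin

text \<open>
  Expanding a product over finite subsets of its index set gives
  \<open>\<Sum>k. B S n k q * x ^ (2 * k) = \<Prod>m. 1 + x\<^sup>2 * q ^ m / (1 + q ^ m)\<^sup>2\<close>, where \<open>m\<close> runs over the positive
  integers congruent to an element of \<open>S\<close>. As \<open>x\<^sup>2 = z - 2 + 1 / z\<close>, the factor at \<open>m\<close> is
  \<open>(1 + z * q ^ m) * (1 + q ^ m / z) / (1 + q ^ m)\<^sup>2\<close>. By the Jacobi triple product, the theta quotient
  for \<open>l\<close> is a power of \<open>z\<close> times the product of the factors \<open>1 + z * q ^ m\<close> with \<open>m \<equiv> l\<close> and
  \<open>1 + q ^ m / z\<close> with \<open>m \<equiv> - l\<close>, normalised at \<open>z = 1\<close>; the reflection \<open>l \<mapsto> n - l\<close> of \<open>S - {n}\<close> matches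
  these products and cancels the powers of \<open>z\<close>. For \<open>l = n\<close> the factor with \<open>m = 0\<close> is
  left over, and it contributes \<open>cos (pi * \<sigma>)\<close>.
\<close>

subsection \<open>The Jacobi triple product\<close>

lemma has_sum_int_shift:
  fixes f :: "int \<Rightarrow> 'a :: {comm_monoid_add, topological_space}"
  assumes "(f has_sum s) UNIV"
  shows "((\<lambda>j. f (j + c)) has_sum s) UNIV"
proof -
  have "bij_betw (\<lambda>j. j + c) UNIV (UNIV :: int set)"
    by (rule bij_betwI[where g = "\<lambda>j. j - c"]) auto
  with assms show ?thesis
    by (subst has_sum_reindex_bij_betw)
qed

text \<open>Enumerating the integers by \<open>int_decode\<close> turns these sums into ordinary
  series, to which Tannery's theorem applies. This justifies the termwise limit in the triple
  product.\<close>

lemma tendsto_infsum_int_dominated: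
  fixes a :: "int \<Rightarrow> nat \<Rightarrow> complex"
  assumes lim: "\<And>j. a j \<longlonglongrightarrow> b j"
    and bound: "\<And>j N. norm (a j N) \<le> M j"
    and M: "M summable_on UNIV"
    and sum: "\<And>N. ((\<lambda>j. a j N) has_sum s N) UNIV"
  shows "s \<longlonglongrightarrow> (\<Sum>\<^sub>\<infinity>j. b j)"
proof -
  have bij: "bij_betw int_decode UNIV UNIV"
    by (rule bij_int_decode)
  have "(\<lambda>k. M (int_decode k)) summable_on UNIV"
    using M summable_on_reindex_bij_betw[OF bij] by fast
  then have "summable (\<lambda>k. M (int_decode k))"
    by (rule summable_on_imp_summable)
  then have T: "summable (\<lambda>k. norm (b (int_decode k)))"
      "(\<lambda>N. \<Sum>k. a (int_decode k) N) \<longlonglongrightarrow> (\<Sum>k. b (int_decode k))"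
    using tannerys_theorem[of "\<lambda>k. a (int_decode k)" "\<lambda>k. b (int_decode k)" sequentially
        "\<lambda>k. M (int_decode k)"] lim bound
    by (auto simp: case_prod_unfold)
  have "s = (\<lambda>N. \<Sum>k. a (int_decode k) N)"
  proof
    fix N
    have "((\<lambda>k. a (int_decode k) N) has_sum s N) UNIV"
      using sum has_sum_reindex_bij_betw[OF bij, of "\<lambda>j. a j N"] by blast
    then show "s N = (\<Sum>k. a (int_decode k) N)"
      by (metis has_sum_imp_sums sums_unique)
  qed
  moreover have "(\<Sum>k. b (int_decode k)) = (\<Sum>\<^sub>\<infinity>j. b j)"
    using norm_summable_imp_has_sum[OF T(1) summable_sums[OF summable_norm_cancel[OF T(1)]]]
      infsum_reindex_bij_betw[OF bij, of b] by (simp add: infsumI)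
  ultimately show ?thesis
    using T(2) by simp
qed

lemma summable_on_int_halves:
  fixes f :: "int \<Rightarrow> real"
  assumes "summable (\<lambda>k. f (int k))" "summable (\<lambda>k. f (- int k))" "\<And>j. f j \<ge> 0"
  shows "f summable_on UNIV"
proof -
  have "(\<lambda>k. f (int k)) summable_on UNIV" "(\<lambda>k. f (- int k)) summable_on UNIV"
    using assms by (auto intro!: norm_summable_imp_summable_on)
  then have "f summable_on range int" "f summable_on range (\<lambda>k. - int k)"
    by (auto simp: summable_on_reindex inj_on_def o_def)
  then have "f summable_on (range int \<union> range (\<lambda>k. - int k))"
    by (rule summable_on_union)
  also have "range int \<union> range (\<lambda>k. - int k) = UNIV"
    by (auto simp: image_iff) (metis int_cases2)
  finally show ?thesis .
qed

text \<open>The term is \<open>(Q ^ k * W) ^ k\<close>, and its base tends to 0 however large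
  \<open>W\<close> is, so a geometric series with ratio 1/2 dominates eventually.\<close>

lemma summable_power_square:
  fixes Q W :: real
  assumes "0 \<le> Q" "Q < 1" "0 \<le> W"
  shows "summable (\<lambda>k. Q ^ (k\<^sup>2) * W ^ k)"
proof -
  have "(\<lambda>k. Q ^ k * W) \<longlonglongrightarrow> 0 * W"
    using assms by (intro tendsto_mult_right LIMSEQ_power_zero) auto
  then have "eventually (\<lambda>k. Q ^ k * W < 1/2) sequentially"
    by (intro order_tendstoD(2)) auto
  then have "eventually (\<lambda>k. norm (Q ^ (k\<^sup>2) * W ^ k) \<le> (1/2) ^ k) sequentially"
  proof eventually_elim
    case (elim k)
    have "Q ^ (k\<^sup>2) * W ^ k = (Q ^ k * W) ^ k"
      by (simp add: power_mult_distrib power2_eq_square power_mult)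
    with elim assms show ?case
      by (auto intro!: power_mono simp: norm_power norm_mult)
  qed
  then show ?thesis
    by (rule summable_comparison_test_ev) (auto intro: summable_geometric)
qed

lemma summable_on_power_int_square:
  fixes Q w :: complex
  assumes "norm Q < 1" "w \<noteq> 0"
  shows "(\<lambda>j::int. norm (Q powi (j\<^sup>2) * w powi j)) summable_on UNIV"
proof (rule summable_on_int_halves)
  have sq: "(int k)\<^sup>2 = int (k\<^sup>2)" for k by simp
  show "summable (\<lambda>k. norm (Q powi ((int k)\<^sup>2) * w powi (int k)))"
    unfolding sq power_int_of_nat
    using summable_power_square[of "norm Q" "norm w"] assms by (simp add: norm_mult norm_power)
  show "summable (\<lambda>k. norm (Q powi ((- int k)\<^sup>2) * w powi (- int k)))"
    unfolding sq power_int_of_nat power2_minus power_int_minus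
    using summable_power_square[of "norm Q" "inverse (norm w)"] assms
    by (simp add: norm_mult norm_power norm_inverse power_inverse)
qed auto

section \<open>q-Pochhammer symbols and the finite triple product\<close>

definition qpoch :: "complex \<Rightarrow> nat \<Rightarrow> complex" where
  "qpoch p N = (\<Prod>i<N. 1 - p ^ Suc i)"

text \<open>The usual convention 1 / (p; p)_k = 0 for negative k. It lets the finite triple product
  be written as a sum over all integers and keeps the recurrence below free of exceptions.\<close>

definition qpoch_inv :: "complex \<Rightarrow> int \<Rightarrow> complex" where
  "qpoch_inv p k = (if k < 0 then 0 else inverse (qpoch p (nat k)))"

lemma one_minus_power_nonzero:
  fixes p :: complex
  assumes "norm p < 1"
  shows "1 - p ^ Suc i \<noteq> 0" "1 + p ^ Suc i \<noteq> 0"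
proof -
  have "norm (p ^ Suc i) < 1"
    using assms by (metis norm_power norm_ge_zero power_less_one_iff zero_less_Suc)
  then show "1 - p ^ Suc i \<noteq> 0" "1 + p ^ Suc i \<noteq> 0"
    by (auto simp: add_eq_0_iff simp del: power_Suc)
qed

lemma qpoch_nonzero: "norm p < 1 \<Longrightarrow> qpoch p N \<noteq> 0"
  using one_minus_power_nonzero(1)[of p] by (simp add: qpoch_def del: power_Suc)

text \<open>For positive \<open>k\<close> the last factor is split off. At \<open>k = 0\<close> the
  left side is 0 by convention and the right side because \<open>1 - p powi 0\<close>
  vanishes.\<close>

lemma qpoch_inv_rec:
  assumes "norm p < 1"
  shows "qpoch_inv p (k - 1) = (1 - p powi k) * qpoch_inv p k"
proof (cases "k > 0")
  case True
  then obtain m where k: "k = int (Suc m)"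
    by (metis gr0_implies_Suc pos_int_cases)
  then have m: "nat k = Suc m" "nat (k - 1) = m" by auto
  show ?thesis
    unfolding qpoch_inv_def m using k qpoch_nonzero[OF assms, of m] one_minus_power_nonzero(1)[OF assms, of m]
    unfolding k power_int_of_nat by (simp add: qpoch_def field_simps)
next
  case False
  then show ?thesis
    by (cases "k = 0") (auto simp: qpoch_inv_def)
qed

text \<open>The coefficients below are Gaussian binomials \<open>[2N choose N + j]\<close> in base \<open>Q\<^sup>2\<close>.\<close>

lemma finite_jacobi_triple_product:
  fixes Q w :: complex
  assumes Q: "norm Q < 1" "Q \<noteq> 0" and w: "w \<noteq> 0"
  shows "((\<lambda>j. Q powi (j\<^sup>2) * qpoch (Q\<^sup>2) (2 * N) * qpoch_inv (Q\<^sup>2) (int N - j) *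
             qpoch_inv (Q\<^sup>2) (int N + j) * w powi j)
          has_sum (\<Prod>k<N. (1 + w * Q ^ (2 * k + 1)) * (1 + Q ^ (2 * k + 1) / w))) UNIV"
proof (induction N)
  case 0
  \<comment> \<open>Only \<open>j = 0\<close> survives: otherwise \<open>j\<close> or
    \<open>- j\<close> is negative and the corresponding \<open>qpoch_inv\<close> is 0.\<close>
  have "((\<lambda>j. Q powi (j\<^sup>2) * qpoch_inv (Q\<^sup>2) (- j) * qpoch_inv (Q\<^sup>2) j * w powi j)
          has_sum 1) UNIV"
    by (rule has_sum_finite_neutralI[of "{0}"]) (auto simp: qpoch_inv_def qpoch_def)
  then show ?case
    by (simp add: qpoch_def)
next
  case (Suc N)
  define p where "p = Q\<^sup>2"
  have p: "norm p < 1" "p \<noteq> 0"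
    using Q by (auto simp: p_def norm_power power_less_one_iff)
  define R where "R = qpoch_inv p"
  define f where "f = (\<lambda>N j. Q powi (j\<^sup>2) * qpoch p (2 * N) * R (int N - j) * R (int N + j) * w powi j)"
  let ?P = "\<lambda>N. \<Prod>k<N. (1 + w * Q ^ (2 * k + 1)) * (1 + Q ^ (2 * k + 1) / w)"
  let ?c = "Q ^ (2 * N + 1)"
  have IH: "(f N has_sum ?P N) UNIV"
    using Suc by (simp add: f_def R_def p_def)
  \<comment> \<open>The factor that is new at \<open>Suc N\<close> expands to
    \<open>1 + ?c\<^sup>2 + ?c * w + ?c / w\<close>. Multiplication by \<open>w\<close> or
    \<open>1 / w\<close> is absorbed by shifting the index by one.\<close>
  have "((\<lambda>j. f N j * (1 + ?c\<^sup>2) + f N (j - 1) * (?c * w) + f N (j + 1) * (?c / w))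
     has_sum (?P N * (1 + ?c\<^sup>2) + ?P N * (?c * w) + ?P N * (?c / w))) UNIV"
    using has_sum_int_shift[OF IH, of "-1"] has_sum_int_shift[OF IH, of 1]
    by (intro has_sum_add has_sum_cmult_left IH) (simp_all only: add_uminus_conv_diff)
  also have "?P N * (1 + ?c\<^sup>2) + ?P N * (?c * w) + ?P N * (?c / w) = ?P (Suc N)"
    using w by (simp add: field_simps power2_eq_square)
  also have "(\<lambda>j. f N j * (1 + ?c\<^sup>2) + f N (j - 1) * (?c * w) + f N (j + 1) * (?c / w)) = f (Suc N)"
  proof
    fix j
    \<comment> \<open>With \<open>u\<close> and \<open>v\<close> all coefficients become multiples
      of \<open>R (int N + 1 - j) * R (int N + 1 + j)\<close>, and the induction step reduces to an
      identity between rational expressions in \<open>u\<close>, \<open>v\<close> and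
      \<open>p\<close>.\<close>
    define u where "u = p powi (int N + 1 - j)"
    define v where "v = p powi (int N + 1 + j)"
    have "R (int N - j) = (1 - u) * R (int N + 1 - j)"
      using qpoch_inv_rec[OF p(1), of "int N + 1 - j"] by (simp add: R_def u_def)
    moreover have "R (int N + j) = (1 - v) * R (int N + 1 + j)"
      using qpoch_inv_rec[OF p(1), of "int N + 1 + j"] by (simp add: R_def v_def)
    moreover have "R (int N - j - 1) = (1 - u / p) * R (int N - j)"
      using qpoch_inv_rec[OF p(1), of "int N - j"] p power_int_diff[of p "int N + 1 - j" 1]
      by (simp add: R_def u_def)
    moreover have "R (int N + j - 1) = (1 - v / p) * R (int N + j)"
      using qpoch_inv_rec[OF p(1), of "int N + j"] p power_int_diff[of p "int N + 1 + j" 1]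
      by (simp add: R_def v_def algebra_simps)
    ultimately have R: "R (int N - j) = (1 - u) * R (int N + 1 - j)"
      "R (int N + j) = (1 - v) * R (int N + 1 + j)"
      "R (int N - j - 1) = (1 - u / p) * (1 - u) * R (int N + 1 - j)"
      "R (int N + j - 1) = (1 - v / p) * (1 - v) * R (int N + 1 + j)"
      by simp_all
    have pow: "p powi k = Q powi (2 * k)" for k
      by (simp add: p_def power_int_mult)
    have cc: "?c = Q powi (int (2 * N + 1))"
      unfolding power_int_of_nat ..
    \<comment> \<open>On exponents of \<open>Q\<close>: (j - 1)^2 + 2N + 1 = j^2 + 2(N + 1 - j), and
      likewise with the opposite sign of j in the next fact.\<close>
    have 1: "Q powi ((j - 1)\<^sup>2) * ?c = Q powi (j\<^sup>2) * u"
      unfolding u_def pow cc using Q(2)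
      by (simp add: power_int_add[symmetric] power2_eq_square algebra_simps del: power_int_of_nat)
    have 2: "Q powi ((j + 1)\<^sup>2) * ?c = Q powi (j\<^sup>2) * v"
      unfolding v_def pow cc using Q(2)
      by (simp add: power_int_add[symmetric] power2_eq_square algebra_simps del: power_int_of_nat)
    have 3: "?c\<^sup>2 = u * v / p"
    proof -
      have "u * v = p powi (int (2 * N + 2))"
        unfolding u_def v_def using p by (simp add: power_int_add[symmetric] algebra_simps)
      also have "\<dots> = p ^ (2 * N + 2)"
        unfolding power_int_of_nat ..
      also have "\<dots> = ?c\<^sup>2 * p"
        by (simp add: p_def power_mult power2_eq_square power_mult_distrib)
      finally show ?thesis using p by simp
    qed
    \<comment> \<open>The two new factors of the Pochhammer symbol have exponents 2N + 1 and 2N + 2,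
      and these powers of \<open>p\<close> are \<open>u * v / p\<close> and
      \<open>u * v\<close>.\<close>
    have 4: "qpoch p (2 * Suc N) = qpoch p (2 * N) * (1 - u * v / p) * (1 - u * v)"
      unfolding 3[symmetric] using 3 p
      by (simp add: qpoch_def p_def power_mult power_mult_distrib power2_eq_square field_simps)
    define T where "T = Q powi (j\<^sup>2) * qpoch p (2 * N) * R (int N + 1 - j) * R (int N + 1 + j) * w powi j"
    have "f N j = T * (1 - u) * (1 - v)"
      unfolding f_def R T_def by (simp add: algebra_simps)
    moreover have "f N (j - 1) * (?c * w) = T * u * (1 - v / p) * (1 - v)"
    proof -
      have "f N (j - 1) * (?c * w) = (Q powi ((j - 1)\<^sup>2) * ?c) * qpoch p (2 * N) * R (int N + 1 - j)
         * R (int N + j - 1) * (w powi (j - 1) * w)"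
        by (simp add: f_def algebra_simps)
      also have "w powi (j - 1) * w = w powi j"
        using w by (simp add: power_int_diff)
      finally show ?thesis
        unfolding 1 R T_def by (simp add: algebra_simps)
    qed
    moreover have "f N (j + 1) * (?c / w) = T * v * (1 - u / p) * (1 - u)"
    proof -
      have "f N (j + 1) * (?c / w) = (Q powi ((j + 1)\<^sup>2) * ?c) * qpoch p (2 * N) * R (int N - j - 1)
         * R (int N + 1 + j) * (w powi (j + 1) / w)"
        by (simp add: f_def algebra_simps)
      also have "w powi (j + 1) / w = w powi j"
        using w by (simp add: power_int_add)
      finally show ?thesis
        unfolding 2 R T_def by (simp add: algebra_simps)
    qed
    moreover have "f (Suc N) j = T * (1 - u * v / p) * (1 - u * v)"
      unfolding f_def 4 T_def by (simp add: algebra_simps)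
    moreover have "T * (1 - u) * (1 - v) * (1 + u * v / p) + T * u * (1 - v / p) * (1 - v) +
        T * v * (1 - u / p) * (1 - u) = T * (1 - u * v / p) * (1 - u * v)"
      using p by (simp add: field_simps)
    ultimately show "f N j * (1 + ?c\<^sup>2) + f N (j - 1) * (?c * w) + f N (j + 1) * (?c / w) = f (Suc N) j"
      by (simp only: 3)
  qed
  finally show ?case
    by (simp only: f_def R_def p_def)
qed

section \<open>Passage to the infinite triple product\<close>

lemma convergent_prod_one_plus_geometric:
  fixes c p :: complex
  assumes "norm p < 1"
  shows "convergent_prod (\<lambda>k. 1 + c * p ^ k)"
proof -
  have "summable (\<lambda>k. norm ((1 + c * p ^ k) - 1))"
    using assms by (auto simp: norm_mult norm_power intro!: summable_mult summable_geometric)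
  then show ?thesis
    by (intro abs_convergent_prod_imp_convergent_prod summable_imp_abs_convergent_prod)
qed

text \<open>A convergent infinite product without zero factors has a nonzero value; this is what
  later allows division by the limit.\<close>

lemma prod_one_plus_geometric_limit:
  fixes c p :: complex
  assumes "norm p < 1" "\<And>k. 1 + c * p ^ k \<noteq> 0"
  obtains L where "L \<noteq> 0" "(\<lambda>N. \<Prod>k<N. 1 + c * p ^ k) \<longlonglongrightarrow> L"
proof
  show "(\<lambda>N. \<Prod>k<N. 1 + c * p ^ k) \<longlonglongrightarrow> prodinf (\<lambda>k. 1 + c * p ^ k)"
    using convergent_prod_LIMSEQ[OF convergent_prod_one_plus_geometric[OF assms(1)], of c]
    by (subst filterlim_sequentially_Suc[symmetric]) (simp add: lessThan_Suc_atMost)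
  show "prodinf (\<lambda>k. 1 + c * p ^ k) \<noteq> 0"
    using convergent_prod_one_plus_geometric[OF assms(1)] assms(2) by (intro prodinf_nonzero) auto
qed

text \<open>Each Gaussian binomial tends to \<open>L * inverse L * inverse L\<close>, where
  \<open>L\<close> is the limit of \<open>qpoch (Q\<^sup>2)\<close>. Thus \<open>K\<close> is
  \<open>inverse L\<close>; its value is left open because a nonzero constant independent of
  \<open>w\<close> cancels in theta quotients.\<close>

lemma jacobi_triple_product_limit:
  fixes Q :: complex
  assumes Q: "norm Q < 1" "Q \<noteq> 0"
  shows "\<exists>K. K \<noteq> 0 \<and> (\<forall>w. w \<noteq> 0 \<longrightarrow>
      (\<lambda>N. \<Prod>k<N. (1 + w * Q ^ (2 * k + 1)) * (1 + Q ^ (2 * k + 1) / w))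
        \<longlonglongrightarrow> K * (\<Sum>\<^sub>\<infinity>j. Q powi (j\<^sup>2) * w powi j))"
proof -
  define p where "p = Q\<^sup>2"
  have p: "norm p < 1" "p \<noteq> 0"
    using Q by (auto simp: p_def norm_power power_less_one_iff)
  have "qpoch p = (\<lambda>N. \<Prod>k<N. 1 + (-p) * p ^ k)"
    by (simp add: qpoch_def fun_eq_iff)
  with prod_one_plus_geometric_limit[of p "-p"] one_minus_power_nonzero(1)[OF p(1)] p
  obtain L where L: "L \<noteq> 0" "qpoch p \<longlonglongrightarrow> L"
    by (metis (no_types, lifting) add_uminus_conv_diff mult_minus_left power_Suc)
  have inv: "(\<lambda>N. inverse (qpoch p N)) \<longlonglongrightarrow> inverse L"
    using L by (intro tendsto_inverse)
  \<comment> \<open>Bounds uniform in \<open>N\<close>, also for the reciprocals because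
    \<open>L\<close> is nonzero. They make \<open>C1 * C2 * C2\<close> times the theta series a
    dominating series.\<close>
  obtain C1 where C1: "\<And>N. norm (qpoch p N) \<le> C1"
    using L(2) by (metis Bseq_def convergentI convergent_imp_Bseq)
  obtain C2 where C2: "C2 > 0" "\<And>N. norm (inverse (qpoch p N)) \<le> C2"
    using inv by (metis Bseq_def convergentI convergent_imp_Bseq)
  have C2': "norm (qpoch_inv p k) \<le> C2" for k
    using C2 by (auto simp: qpoch_inv_def)
  have C10: "C1 \<ge> 0" using C1[of 0] norm_ge_zero order_trans by blast
  have lim_inv: "(\<lambda>N. qpoch_inv p (int N + j)) \<longlonglongrightarrow> inverse L" for j
  proof -
    have "filterlim (\<lambda>N. nat (int N + j)) at_top sequentially"
      unfolding filterlim_at_top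
    proof
      fix Z
      show "eventually (\<lambda>N. Z \<le> nat (int N + j)) sequentially"
        using eventually_ge_at_top[of "Z + nat \<bar>j\<bar>"] by eventually_elim auto
    qed
    with inv have "(\<lambda>N. inverse (qpoch p (nat (int N + j)))) \<longlonglongrightarrow> inverse L"
      by (rule filterlim_compose)
    \<comment> \<open>The default value 0 of \<open>qpoch_inv\<close> concerns only the finitely
      many \<open>N\<close> with \<open>int N + j < 0\<close>.\<close>
    moreover have "eventually (\<lambda>N. inverse (qpoch p (nat (int N + j))) = qpoch_inv p (int N + j)) sequentially"
      using eventually_ge_at_top[of "nat \<bar>j\<bar>"] by eventually_elim (auto simp: qpoch_inv_def)
    ultimately show ?thesis
      by (rule Lim_transform_eventually)
  qed
  have lim2: "(\<lambda>N. qpoch p (2 * N)) \<longlonglongrightarrow> L"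
    using LIMSEQ_subseq_LIMSEQ[OF L(2), of "\<lambda>N. 2 * N"] by (simp add: o_def strict_mono_def)
  show ?thesis
  proof (intro exI[of _ "inverse L"] conjI allI impI)
    show "inverse L \<noteq> 0" using L by simp
    fix w :: complex assume w: "w \<noteq> 0"
    have "(\<lambda>N. \<Prod>k<N. (1 + w * Q ^ (2 * k + 1)) * (1 + Q ^ (2 * k + 1) / w))
        \<longlonglongrightarrow> (\<Sum>\<^sub>\<infinity>j. Q powi (j\<^sup>2) * L * inverse L * inverse L * w powi j)"
    proof (rule tendsto_infsum_int_dominated[OF _ _ _ finite_jacobi_triple_product[OF Q w]], unfold p_def[symmetric])
      show "(\<lambda>N. Q powi j\<^sup>2 * qpoch p (2 * N) * qpoch_inv p (int N - j) * qpoch_inv p (int N + j) * w powi j)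
         \<longlonglongrightarrow> Q powi j\<^sup>2 * L * inverse L * inverse L * w powi j" for j
        using lim_inv[of j] lim_inv[of "-j"] lim2 by (intro tendsto_intros) auto
      show "norm (Q powi j\<^sup>2 * qpoch p (2 * N) * qpoch_inv p (int N - j) * qpoch_inv p (int N + j) * w powi j)
         \<le> (C1 * C2 * C2) * norm (Q powi j\<^sup>2 * w powi j)" for j N
      proof -
        have "norm (qpoch p (2 * N)) * norm (qpoch_inv p (int N - j)) * norm (qpoch_inv p (int N + j)) \<le> C1 * C2 * C2"
          using C1 C2' C2(1) C10 by (intro mult_mono) auto
        from mult_right_mono[OF this norm_ge_zero[of "Q powi j\<^sup>2 * w powi j"]] show ?thesis
          by (simp add: norm_mult mult_ac)
      qed
      show "(\<lambda>j. (C1 * C2 * C2) * norm (Q powi j\<^sup>2 * w powi j)) summable_on UNIV"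
        using summable_on_power_int_square[OF Q(1) w] by (rule summable_on_cmult_right)
    qed
    also have "(\<lambda>j::int. Q powi (j\<^sup>2) * L * inverse L * inverse L * w powi j) =
        (\<lambda>j. inverse L * (Q powi (j\<^sup>2) * w powi j))"
      using L by (auto simp: field_simps)
    also have "(\<Sum>\<^sub>\<infinity>j::int. inverse L * (Q powi (j\<^sup>2) * w powi j)) = inverse L * (\<Sum>\<^sub>\<infinity>j. Q powi (j\<^sup>2) * w powi j)"
      by (rule infsum_cmult_right')
    finally show "(\<lambda>N. \<Prod>k<N. (1 + w * Q ^ (2 * k + 1)) * (1 + Q ^ (2 * k + 1) / w))
        \<longlonglongrightarrow> inverse L * (\<Sum>\<^sub>\<infinity>j. Q powi (j\<^sup>2) * w powi j)" .
  qed
qed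

subsection \<open>Generating functions of elementary symmetric functions\<close>

lemma prod_one_plus_eq_sum_Pow:
  fixes f :: "'a \<Rightarrow> 'b :: comm_semiring_1"
  assumes "finite A"
  shows "(\<Prod>m\<in>A. 1 + f m) = (\<Sum>X\<in>Pow A. prod f X)"
proof -
  have "(\<Prod>m\<in>A. 1 + f m) = (\<Prod>m\<in>A. f m + 1)"
    by (simp add: add.commute)
  also have "\<dots> = (\<Sum>X\<in>Pow A. prod f X)"
    by (subst prod_add[OF assms]) simp
  finally show ?thesis .
qed

text \<open>A finite family of subsets lies in the power set of its union, and the sum over that
  power set is the product of the factors \<open>1 + norm (f m)\<close>, bounded by the exponential
  of the total sum.\<close>

lemma abs_summable_on_finite_subsets_prod:
  fixes f :: "'a \<Rightarrow> complex"
  assumes "(\<lambda>m. norm (f m)) summable_on M"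
  shows "(\<lambda>X. norm (prod f X)) summable_on {X. finite X \<and> X \<subseteq> M}"
proof (rule nonneg_bdd_above_summable_on)
  show "bdd_above (sum (\<lambda>X. norm (prod f X)) ` {F. F \<subseteq> {X. finite X \<and> X \<subseteq> M} \<and> finite F})"
  proof (rule bdd_aboveI2)
    fix F assume F: "F \<in> {F. F \<subseteq> {X. finite X \<and> X \<subseteq> M} \<and> finite F}"
    then have U: "finite (\<Union>F)" "\<Union>F \<subseteq> M" by auto
    have "(\<Sum>X\<in>F. norm (prod f X)) \<le> (\<Sum>X\<in>Pow (\<Union>F). norm (prod f X))"
      using U by (intro sum_mono2) auto
    also have "\<dots> = (\<Prod>m\<in>\<Union>F. 1 + norm (f m))"
      by (simp add: prod_one_plus_eq_sum_Pow[OF U(1)] prod_norm)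
    also have "\<dots> \<le> exp (\<Sum>m\<in>\<Union>F. norm (f m))"
      by (rule prod_le_exp_sum) auto
    also have "\<dots> \<le> exp (\<Sum>\<^sub>\<infinity>m\<in>M. norm (f m))"
      using finite_sum_le_infsum[OF assms U] by simp
    finally show "(\<Sum>X\<in>F. norm (prod f X)) \<le> exp (\<Sum>\<^sub>\<infinity>m\<in>M. norm (f m))" .
  qed
qed auto

text \<open>The truncated product is the sum over the power set of
  \<open>M \<inter> {..c N}\<close>, and these power sets eventually contain every finite family of
  finite subsets of \<open>M\<close>. The cutoff \<open>c\<close> is kept free so that it can be
  taken at multiples of \<open>n\<close>.\<close>

lemma tendsto_prod_finite_subsets:
  fixes f :: "nat \<Rightarrow> complex"
  assumes f: "(prod f has_sum L) {X. finite X \<and> X \<subseteq> M}"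
    and c: "filterlim c at_top sequentially"
  shows "(\<lambda>N. \<Prod>m\<in>M \<inter> {..c N}. 1 + f m) \<longlonglongrightarrow> L"
proof -
  let ?F = "{X. finite X \<and> X \<subseteq> M}"
  have "filterlim (\<lambda>N. Pow (M \<inter> {..c N})) (finite_subsets_at_top ?F) sequentially"
    unfolding filterlim_finite_subsets_at_top
  proof (intro allI impI)
    fix X assume X: "finite X \<and> X \<subseteq> ?F"
    then have "finite (\<Union>X)" by auto
    then obtain N0 where N0: "\<Union>X \<subseteq> {..N0}"
      using finite_nat_iff_bounded_le by auto
    have "\<forall>\<^sub>F N in sequentially. N0 \<le> c N"
      using c by (simp add: filterlim_at_top)
    then show "\<forall>\<^sub>F N in sequentially. finite (Pow (M \<inter> {..c N})) \<and> X \<subseteq> Pow (M \<inter> {..c N}) \<and>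
        Pow (M \<inter> {..c N}) \<subseteq> ?F"
    proof eventually_elim
      case (elim N)
      with N0 X show ?case
        by (auto intro: finite_subset)
    qed
  qed
  from filterlim_compose[OF f[unfolded has_sum_def] this] show ?thesis
    by (simp add: prod_one_plus_eq_sum_Pow)
qed

text \<open>The finite subsets of \<open>M\<close> are graded by cardinality. Absolute convergence
  permits summing grade by grade, which gives the power series in \<open>y\<close>, or along
  truncations, which gives the product; both have the limit \<open>L\<close>.\<close>

lemma elementary_symmetric_sums:
  fixes u :: "nat \<Rightarrow> complex"
  assumes u: "(\<lambda>m. norm (u m)) summable_on M"
  shows "\<exists>L. (\<lambda>k. (\<Sum>\<^sub>\<infinity>X\<in>{X. finite X \<and> X \<subseteq> M \<and> card X = k}. prod u X) * y ^ k) sums L \<and>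
    (\<forall>c. filterlim c at_top sequentially \<longrightarrow> (\<lambda>N. \<Prod>m\<in>M \<inter> {..c N}. 1 + y * u m) \<longlonglongrightarrow> L)"
proof -
  let ?S = "\<lambda>k. {X. finite X \<and> X \<subseteq> M \<and> card X = k}"
  let ?f = "prod (\<lambda>m. y * u m)"
  have yu: "(\<lambda>m. norm (y * u m)) summable_on M"
    using u by (simp add: norm_mult summable_on_cmult_right)
  have sm: "?f summable_on {X. finite X \<and> X \<subseteq> M}"
    using abs_summable_summable[OF abs_summable_on_finite_subsets_prod[OF yu]] .
  then obtain L where L: "(?f has_sum L) {X. finite X \<and> X \<subseteq> M}"
    by (auto simp: summable_on_def)
  moreover have bij: "bij_betw snd (Sigma UNIV ?S) {X. finite X \<and> X \<subseteq> M}"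
    by (rule bij_betwI[where g = "\<lambda>X. (card X, X)"]) auto
  ultimately have "((\<lambda>z. ?f (snd z)) has_sum L) (Sigma UNIV ?S)"
    by (subst has_sum_reindex_bij_betw)
  then have *: "((\<lambda>(k, X). ?f X) has_sum L) (Sigma UNIV ?S)"
    by (simp add: case_prod_unfold)
  have sm': "?f summable_on ?S k" for k
    using sm by (rule summable_on_subset_banach) auto
  have "((\<lambda>k. infsum ?f (?S k)) has_sum L) UNIV"
    by (rule has_sum_SigmaD[OF *]) (use sm' in auto)
  then have "(\<lambda>k. infsum ?f (?S k)) sums L"
    by (rule has_sum_imp_sums)
  moreover have "infsum ?f (?S k) = infsum (prod u) (?S k) * y ^ k" for k
  proof -
    have "infsum ?f (?S k) = (\<Sum>\<^sub>\<infinity>X\<in>?S k. y ^ k * prod u X)"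
      by (intro infsum_cong) (auto simp: prod.distrib)
    then show ?thesis
      unfolding infsum_cmult_right' by (simp only: mult.commute)
  qed
  ultimately show ?thesis
    using tendsto_prod_finite_subsets[OF L] by auto
qed

text \<open>A strictly increasing list is the sorted list of its set of entries, and the summand is
  multiplicative over the entries.\<close>

lemma B_eq_infsum_finite_sets:
  "B S n k q = (\<Sum>\<^sub>\<infinity>X\<in>{X. finite X \<and> X \<subseteq> {m. 0 < m \<and> in_mod m S n} \<and> card X = k}.
     \<Prod>m\<in>X. q ^ m / (1 + q ^ m)\<^sup>2)"
  unfolding B_def
proof (rule infsum_reindex_bij_witness[where i = sorted_list_of_set and j = set])
  fix ms :: "nat list"
  assume "ms \<in> {ms. length ms = k \<and> sorted_wrt (<) ms \<and> (\<forall>m\<in>set ms. 0 < m \<and> in_mod m S n)}"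
  then have ms: "length ms = k" "sorted ms" "distinct ms" "\<forall>m\<in>set ms. 0 < m \<and> in_mod m S n"
    by (auto simp: strict_sorted_iff)
  then show "sorted_list_of_set (set ms) = ms"
    by (simp add: sorted_distinct_set_unique)
  show "set ms \<in> {X. finite X \<and> X \<subseteq> {m. 0 < m \<and> in_mod m S n} \<and> card X = k}"
    using ms by (auto simp: distinct_card)
  have "(\<Prod>m\<in>set ms. q ^ m / (1 + q ^ m)\<^sup>2) = (\<Prod>m\<leftarrow>ms. q ^ m / (1 + q ^ m)\<^sup>2)"
    using ms by (simp add: prod.distinct_set_conv_list)
  also have "\<dots> = q ^ sum_list ms / (\<Prod>m\<leftarrow>ms. (1 + q ^ m)\<^sup>2)"
    by (induction ms) (simp_all add: power_add)
  finally show "(\<Prod>m\<in>set ms. q ^ m / (1 + q ^ m)\<^sup>2) = q ^ sum_list ms / (\<Prod>m\<leftarrow>ms. (1 + q ^ m)\<^sup>2)" .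
qed (auto simp: strict_sorted_iff)

text \<open>As \<open>1 + q ^ m\<close> tends to 1, its norm eventually exceeds 1/2, which gives a
  geometric bound with constant 4.\<close>

lemma summable_Lambert_terms:
  fixes q :: complex
  assumes "norm q < 1"
  shows "(\<lambda>m. norm (q ^ m / (1 + q ^ m)\<^sup>2)) summable_on UNIV"
proof -
  have "(\<lambda>m. q ^ m) \<longlonglongrightarrow> 0"
    using assms by (rule LIMSEQ_power_zero)
  then have "(\<lambda>m. norm (1 + q ^ m)) \<longlonglongrightarrow> norm (1 + 0 :: complex)"
    by (intro tendsto_norm tendsto_add tendsto_const)
  then have "eventually (\<lambda>m. norm (1 + q ^ m) > 1/2) sequentially"
    by (intro order_tendstoD(1)) auto
  then have "eventually (\<lambda>m. norm (norm (q ^ m / (1 + q ^ m)\<^sup>2)) \<le> 4 * norm q ^ m) sequentially"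
  proof eventually_elim
    case (elim m)
    then have "(1/2)\<^sup>2 \<le> norm (1 + q ^ m) ^ 2"
      by (intro power_mono) auto
    then have "1 \<le> 4 * norm (1 + q ^ m) ^ 2"
      by (simp add: power2_eq_square)
    from mult_left_mono[OF this, of "norm q ^ m"] elim show ?case
      by (auto simp: norm_divide norm_power divide_simps algebra_simps)
  qed
  then have "summable (\<lambda>m. norm (q ^ m / (1 + q ^ m)\<^sup>2))"
    by (rule summable_comparison_test_ev) (use assms in \<open>auto intro!: summable_mult summable_geometric simp del: summable_geometric_iff\<close>)
  then show ?thesis
    by (auto intro!: norm_summable_imp_summable_on)
qed

lemma B_sums:
  assumes "norm q < 1"
  shows "\<exists>L. (\<lambda>k. B S n k q * x ^ (2 * k)) sums L \<and>
    (\<forall>c. filterlim c at_top sequentially \<longrightarrow>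
      (\<lambda>N. \<Prod>m\<in>{m. 0 < m \<and> in_mod m S n} \<inter> {..c N}. 1 + x\<^sup>2 * (q ^ m / (1 + q ^ m)\<^sup>2)) \<longlonglongrightarrow> L)"
proof -
  have "(\<lambda>m. norm (q ^ m / (1 + q ^ m)\<^sup>2)) summable_on {m. 0 < m \<and> in_mod m S n}"
    using summable_Lambert_terms[OF assms] by (rule summable_on_subset_banach) auto
  from elementary_symmetric_sums[OF this, of "x\<^sup>2"] show ?thesis
    unfolding B_eq_infsum_finite_sets power_mult by blast
qed

subsection \<open>Theta quotients and residue classes\<close>

text \<open>Expanding (j + r)^2 moves all fractional powers into the prefactor and leaves the
  integral powers to which the triple product applies.\<close>

lemma theta_eq_power_int_sum:
  "theta r \<tau> \<sigma> = exp (pi * \<i> * \<tau> * (of_rat r)\<^sup>2) * exp (2 * pi * \<i> * of_rat r * \<sigma>) *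
     (\<Sum>\<^sub>\<infinity>j. exp (pi * \<i> * \<tau>) powi (j\<^sup>2) * exp (2 * pi * \<i> * (of_rat r * \<tau> + \<sigma>)) powi j)"
proof -
  have "{of_int j + r |j::int. True} = range (\<lambda>j. of_int j + r)"
    by auto
  then have "theta r \<tau> \<sigma> = (\<Sum>\<^sub>\<infinity>j::int.
      exp (pi * \<i> * \<tau> * (of_int j + of_rat r)\<^sup>2) * exp (2 * pi * \<i> * (of_int j + of_rat r) * \<sigma>))"
    unfolding theta_def
    by (simp add: infsum_reindex inj_on_def o_def of_rat_add)
  also have "\<dots> = (\<Sum>\<^sub>\<infinity>j. exp (pi * \<i> * \<tau> * (of_rat r)\<^sup>2) * exp (2 * pi * \<i> * of_rat r * \<sigma>) *
     (exp (pi * \<i> * \<tau>) powi (j\<^sup>2) * exp (2 * pi * \<i> * (of_rat r * \<tau> + \<sigma>)) powi j))"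
    by (intro infsum_cong)
       (simp add: exp_power_int exp_add[symmetric] power2_eq_square algebra_simps)
  finally show ?thesis
    by (simp only: infsum_cmult_right')
qed

text \<open>In the quotient of two triple products both \<open>K\<close> and
  \<open>exp (pi * \<i> * (of_nat n * \<tau>) * r\<^sup>2)\<close> cancel. What remains of the
  prefactors is z^r, which the exponential on the right undoes.\<close>

lemma theta_ratio_limit:
  assumes n: "n > 0" and l: "l \<in> {1..n}" and \<tau>: "Im \<tau> > 0"
    and q: "q = exp (2 * pi * \<i> * \<tau>)" and z: "z = exp (2 * pi * \<i> * \<sigma>)"
  shows "(\<lambda>N. \<Prod>k<N. (1 + z * q ^ (n * k + l)) * (1 + q ^ (n * k + (n - l)) / z) /
                ((1 + q ^ (n * k + l)) * (1 + q ^ (n * k + (n - l)))))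
     \<longlonglongrightarrow> exp (- (2 * pi * \<i> * of_rat (alpha n l) * \<sigma>)) *
        (theta (alpha n l) (of_nat n * \<tau>) \<sigma> / theta0 (alpha n l) (of_nat n * \<tau>))"
proof -
  define r :: complex where "r = of_rat (alpha n l)"
  have r: "r = of_nat l / of_nat n - 1 / 2"
    by (simp add: r_def alpha_def of_rat_diff of_rat_divide)
  define Q where "Q = exp (pi * \<i> * (of_nat n * \<tau>))"
  define w where "w = (\<lambda>\<sigma>. exp (2 * pi * \<i> * (r * (of_nat n * \<tau>) + \<sigma>)))"
  define S where "S = (\<lambda>\<sigma>. \<Sum>\<^sub>\<infinity>j. Q powi (j\<^sup>2) * w \<sigma> powi j)"
  have normq: "norm q < 1"
    using \<tau> by (simp add: q)
  have qn: "norm (q ^ n) < 1"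
    using normq n by (simp add: norm_power power_less_one_iff)
  have Q: "norm Q < 1" "Q \<noteq> 0"
    using \<tau> n by (auto simp: Q_def)
  obtain K where K: "K \<noteq> 0" "\<And>w. w \<noteq> 0 \<Longrightarrow>
      (\<lambda>N. \<Prod>k<N. (1 + w * Q ^ (2 * k + 1)) * (1 + Q ^ (2 * k + 1) / w))
        \<longlonglongrightarrow> K * (\<Sum>\<^sub>\<infinity>j. Q powi (j\<^sup>2) * w powi j)"
    using jacobi_triple_product_limit[OF Q] by blast
  have qpow: "q ^ k = exp (2 * pi * \<i> * \<tau> * of_nat k)" for k
    by (simp add: q exp_of_nat_mult[symmetric] mult_ac)
  have Qpow: "Q ^ k = exp (pi * \<i> * (of_nat n * \<tau>) * of_nat k)" for k
    by (simp add: Q_def exp_of_nat_mult[symmetric] mult_ac)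
  \<comment> \<open>Here \<open>n * r\<close> is \<open>l - n / 2\<close>, and the shift by 1/2 in
    \<open>alpha\<close> compensates the half-integral power of q^n in
    \<open>Q ^ (2 * k + 1)\<close>.\<close>
  have w1: "w \<sigma> * Q ^ (2 * k + 1) = exp (2 * pi * \<i> * \<sigma>) * q ^ (n * k + l)" for \<sigma> k
    unfolding w_def Qpow qpow exp_add[symmetric] r using n
    by (intro arg_cong[of _ _ exp]) (simp add: field_simps)
  have w2: "Q ^ (2 * k + 1) / w \<sigma> = q ^ (n * k + (n - l)) / exp (2 * pi * \<i> * \<sigma>)" for \<sigma> k
    unfolding w_def Qpow qpow exp_diff[symmetric] r using n l
    by (intro arg_cong[of _ _ exp]) (simp add: field_simps of_nat_diff)
  have lim: "(\<lambda>N. \<Prod>k<N. (1 + exp (2 * pi * \<i> * \<sigma>) * q ^ (n * k + l)) *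
      (1 + q ^ (n * k + (n - l)) / exp (2 * pi * \<i> * \<sigma>))) \<longlonglongrightarrow> K * S \<sigma>" for \<sigma>
    using K(2)[of "w \<sigma>"] unfolding w1 w2 S_def by (simp add: w_def)
  have lim0: "(\<lambda>N. \<Prod>k<N. (1 + q ^ (n * k + l)) * (1 + q ^ (n * k + (n - l)))) \<longlonglongrightarrow> K * S 0"
    using lim[of 0] by simp
  have nz: "1 + q ^ m \<noteq> 0" for m
    using one_minus_power_nonzero(2)[OF normq] by (cases m) auto
  have nz': "1 + q ^ m * (q ^ n) ^ k \<noteq> 0" for m k
    using nz[of "m + n * k"] by (simp add: power_add power_mult)
  \<comment> \<open>The product at \<open>\<sigma> = 0\<close> is computed a second time, as a
    product of two nonzero limits, to show that the theta constant does not vanish.\<close>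
  obtain L1 where L1: "L1 \<noteq> 0" "(\<lambda>N. \<Prod>k<N. 1 + q ^ l * (q ^ n) ^ k) \<longlonglongrightarrow> L1"
    using prod_one_plus_geometric_limit[OF qn nz'] .
  obtain L2 where L2: "L2 \<noteq> 0" "(\<lambda>N. \<Prod>k<N. 1 + q ^ (n - l) * (q ^ n) ^ k) \<longlonglongrightarrow> L2"
    using prod_one_plus_geometric_limit[OF qn nz'] .
  have "(\<lambda>N. \<Prod>k<N. (1 + q ^ (n * k + l)) * (1 + q ^ (n * k + (n - l)))) \<longlonglongrightarrow> L1 * L2"
    using tendsto_mult[OF L1(2) L2(2)]
    by (simp add: prod.distrib add.commute[of "n * _"] power_add power_mult)
  with lim0 have "K * S 0 = L1 * L2"
    using LIMSEQ_unique by blast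
  with L1 L2 have S0: "K * S 0 \<noteq> 0" by auto
  have th: "theta (alpha n l) (of_nat n * \<tau>) \<sigma> =
      exp (pi * \<i> * (of_nat n * \<tau>) * r\<^sup>2) * exp (2 * pi * \<i> * r * \<sigma>) * S \<sigma>" for \<sigma>
    unfolding theta_eq_power_int_sum S_def Q_def w_def r_def ..
  have "exp (- (2 * pi * \<i> * r * \<sigma>)) *
      (theta (alpha n l) (of_nat n * \<tau>) \<sigma> / theta0 (alpha n l) (of_nat n * \<tau>)) = K * S \<sigma> / (K * S 0)"
    using S0 unfolding theta0_def th exp_minus by simp
  moreover have "(\<lambda>N. \<Prod>k<N. (1 + z * q ^ (n * k + l)) * (1 + q ^ (n * k + (n - l)) / z) /
      ((1 + q ^ (n * k + l)) * (1 + q ^ (n * k + (n - l))))) \<longlonglongrightarrow> K * S \<sigma> / (K * S 0)"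
    unfolding prod_dividef z by (rule tendsto_divide[OF lim lim0 S0])
  ultimately show ?thesis
    unfolding r_def by simp
qed

section \<open>Symmetric sets of representatives and their residue classes\<close>

lemma symmetric_reps_reflect:
  assumes S: "symmetric_reps n S" and l: "l \<in> S" "l \<noteq> n"
  shows "n - l \<in> S - {n}"
proof -
  have ln: "1 \<le> l" "l < n"
    using S l by (auto simp: symmetric_reps_def dest!: subsetD)
  obtain l' where l': "l' \<in> S" "[int l' = - int l] (mod int n)"
    using S l by (auto simp: symmetric_reps_def)
  then have l'n: "1 \<le> l'" "l' \<le> n"
    using S by (auto simp: symmetric_reps_def)
  \<comment> \<open>The sum \<open>l' + l\<close> is a multiple of \<open>n\<close> strictly between
    0 and 2n, hence equal to \<open>n\<close>; the upper bound is strict because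
    \<open>l < n\<close>.\<close>
  have "int n dvd int (l' + l)"
    using l'(2) by (simp add: cong_iff_dvd_diff)
  then have "n dvd l' + l"
    by (simp only: int_dvd_int_iff)
  then obtain c where c: "l' + l = n * c" ..
  have "0 < c" using c ln by (cases c) auto
  moreover have "n * c < n * 2"
    using c ln l'n by linarith
  then have "c < 2" by (rule mult_less_cancel1[THEN iffD1, THEN conjunct2])
  ultimately have "c = 1" by simp
  with c ln l' show ?thesis by (auto simp flip: c)
qed

lemma bij_betw_symmetric_reps_reflect:
  assumes S: "symmetric_reps n S"
  shows "bij_betw (\<lambda>l. n - l) (S - {n}) (S - {n})"
proof (rule bij_betwI[where g = "\<lambda>l. n - l"])
qed (use symmetric_reps_reflect[OF S] S in \<open>auto simp: symmetric_reps_def\<close>)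

text \<open>The reflection from \<open>l\<close> to \<open>n - l\<close> changes the sign of
  \<open>alpha\<close>, so the sum equals its own negative.\<close>

lemma sum_alpha_symmetric_reps:
  assumes n: "n > 0" and S: "symmetric_reps n S"
  shows "(\<Sum>l\<in>S - {n}. of_rat (alpha n l) :: complex) = 0"
proof -
  have "(\<Sum>l\<in>S - {n}. of_rat (alpha n l) :: complex) = (\<Sum>l\<in>S - {n}. of_rat (alpha n (n - l)))"
    by (rule sum.reindex_bij_betw[OF bij_betw_symmetric_reps_reflect[OF S], symmetric])
  also have "\<dots> = (\<Sum>l\<in>S - {n}. - of_rat (alpha n l))"
  proof (rule sum.cong)
    fix l assume "l \<in> S - {n}"
    with S have "l \<le> n" by (auto simp: symmetric_reps_def)
    then have "alpha n (n - l) = - alpha n l"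
      using n by (simp add: alpha_def of_nat_diff field_simps)
    then show "of_rat (alpha n (n - l)) = - (of_rat (alpha n l) :: complex)"
      by (simp add: of_rat_minus)
  qed simp
  finally show ?thesis
    by (simp add: sum_negf)
qed

text \<open>Every positive integer is uniquely \<open>n * k + l\<close> with \<open>l\<close> in
  \<open>{1..n}\<close>, and the cutoff \<open>n * N\<close> retains exactly the first
  \<open>N\<close> members of each class.\<close>

lemma prod_residue_classes:
  assumes n: "n > 0" and S: "S \<subseteq> {1..n}"
  shows "prod g ({m. 0 < m \<and> in_mod m S n} \<inter> {..n * N}) = (\<Prod>l\<in>S. \<Prod>k<N. g (n * k + l))"
proof -
  have "bij_betw (\<lambda>(l, k). n * k + l) (S \<times> {..<N}) ({m. 0 < m \<and> in_mod m S n} \<inter> {..n * N})"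
    unfolding bij_betw_def
  proof
    show "inj_on (\<lambda>(l, k). n * k + l) (S \<times> {..<N})"
    proof (rule inj_onI, clarify)
      fix l k l' k' assume *: "l \<in> S" "l' \<in> S" "n * k + l = n * k' + l'"
      then have ll: "1 \<le> l" "l \<le> n" "1 \<le> l'" "l' \<le> n" using S by auto
      \<comment> \<open>Representatives run from 1 to \<open>n\<close>, so one is subtracted before
        Euclidean division; \<open>l = n\<close> would otherwise raise the quotient.\<close>
      have "n * k + (l - 1) = n * k' + (l' - 1)"
        using * ll by linarith
      moreover have "(n * k + (l - 1)) div n = k" "(n * k' + (l' - 1)) div n = k'"
        using ll n by (simp_all only: div_mult_self4) auto
      ultimately have "k = k'" by simp
      with * show "l = l' \<and> k = k'" by simp
    qed
    show "(\<lambda>(l, k). n * k + l) ` (S \<times> {..<N}) = {m. 0 < m \<and> in_mod m S n} \<inter> {..n * N}"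
    proof (intro equalityI subsetI)
      fix m assume "m \<in> (\<lambda>(l, k). n * k + l) ` (S \<times> {..<N})"
      then obtain l k where lk: "l \<in> S" "k < N" "m = n * k + l" by auto
      then have "1 \<le> l" "l \<le> n" using S by auto
      moreover have "n * k + n \<le> n * N"
        using lk(2) by (metis Suc_leI mult_Suc_right add.commute mult_le_mono2)
      ultimately show "m \<in> {m. 0 < m \<and> in_mod m S n} \<inter> {..n * N}"
        using lk by (auto simp: in_mod_def cong_def intro!: bexI[of _ l])
    next
      fix m assume m: "m \<in> {m. 0 < m \<and> in_mod m S n} \<inter> {..n * N}"
      then obtain l where l: "l \<in> S" "[m = l] (mod n)" by (auto simp: in_mod_def)
      then have ln: "1 \<le> l" "l \<le> n" using S by auto
      have "[m - 1 = l - 1] (mod n)"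
        using l m ln by (intro cong_diff_nat) auto
      then have "(m - 1) mod n = l - 1"
        using ln n by (auto simp: cong_def)
      then have "n * ((m - 1) div n) + (l - 1) = m - 1"
        by (metis mult_div_mod_eq)
      then have "m = n * ((m - 1) div n) + l"
        using m ln by auto
      moreover have "(m - 1) div n < N"
        using m n by (intro div_less_iff_less_mult[THEN iffD2]) (auto simp: mult.commute)
      ultimately show "m \<in> (\<lambda>(l, k). n * k + l) ` (S \<times> {..<N})"
        using l by (intro image_eqI[of _ _ "(l, (m - 1) div n)"]) auto
    qed
  qed
  from prod.reindex_bij_betw[OF this, of g] show ?thesis
    by (simp add: prod.cartesian_product case_prod_unfold)
qed

text \<open>The squares of \<open>w\<close> and the cosine agree. Near 0 their sum is nonzero, its
  value at 0 being 2, so there the functions themselves agree, and analytic continuation carries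
  this over the connected set \<open>D\<close>.\<close>

lemma sqrt_branch_on_unique:
  fixes \<sigma> :: complex
  assumes "sqrt_branch_on D w" "\<sigma> \<in> D"
  shows "w \<sigma> = cos (pi * \<sigma>)"
proof -
  let ?c = "\<lambda>\<sigma>::complex. cos (pi * \<sigma>)"
  from assms(1) have D: "open D" "connected D" "0 \<in> D" and w: "w holomorphic_on D" "w 0 = 1"
    and sq: "\<And>\<sigma>. \<sigma> \<in> D \<Longrightarrow> (w \<sigma>)\<^sup>2 = (?c \<sigma>)\<^sup>2"
    by (auto simp: sqrt_branch_on_def xvar_cos)
  have "continuous_on D (\<lambda>\<sigma>. w \<sigma> + ?c \<sigma>)"
    using w(1) by (intro continuous_intros holomorphic_on_imp_continuous_on)
  then have op: "open (D \<inter> (\<lambda>\<sigma>. w \<sigma> + ?c \<sigma>) -` (- {0}))"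
    using D(1) by (intro continuous_open_preimage) auto
  show ?thesis
  proof (rule analytic_continuation_open[where f = w and g = ?c, OF op D(1) _ D(2)])
    show "D \<inter> (\<lambda>\<sigma>. w \<sigma> + ?c \<sigma>) -` (- {0}) \<noteq> {}"
      using D(3) w(2) by auto
    show "w holomorphic_on D" "?c holomorphic_on D"
      using w by (auto intro!: holomorphic_intros)
    fix s assume "s \<in> D \<inter> (\<lambda>\<sigma>. w \<sigma> + ?c \<sigma>) -` (- {0})"
    with sq[of s] show "w s = ?c s"
      by (auto simp: power2_eq_iff)
  qed (use assms in auto)
qed

text \<open>This is (1 + z a)(1 + a/z) = (1 + a)^2 + a (z - 2 + 1/z), divided by (1 + a)^2.\<close>

lemma Lambert_factor:
  fixes z a x :: complex
  assumes "z \<noteq> 0" "1 + a \<noteq> 0" "x\<^sup>2 = z - 2 + 1 / z"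
  shows "1 + x\<^sup>2 * (a / (1 + a)\<^sup>2) = (1 + z * a) * (1 + a / z) / ((1 + a) * (1 + a))"
  using assms(1,2) unfolding assms(3) by (simp add: divide_simps power2_eq_square) (simp add: algebra_simps)

theorem theorem1p10:
  fixes n :: nat and S :: "nat set" and \<tau> \<sigma> q x :: complex
  assumes "n > 0" and "symmetric_reps n S"
    and "Im \<tau> > 0" and "q = exp (2 * pi * \<i> * \<tau>)"
    and "x = xvar \<sigma>"
  shows "(n \<notin> S \<longrightarrow>
           (\<lambda>k. B S n k q * x ^ (2 * k)) sums
             (\<Prod>l\<in>S. theta (alpha n l) (of_nat n * \<tau>) \<sigma> / theta0 (alpha n l) (of_nat n * \<tau>))) \<and>
         (n \<in> S \<longrightarrow>
           summable (\<lambda>k. B S n k q * x ^ (2 * k)) \<and>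
           (\<forall>D w. sqrt_branch_on D w \<and> \<sigma> \<in> D \<longrightarrow>
             w \<sigma> * (\<Sum>k. B S n k q * x ^ (2 * k)) =
               (\<Prod>l\<in>S. theta (alpha n l) (of_nat n * \<tau>) \<sigma>) /
               (\<Prod>l\<in>S. theta0 (alpha n l) (of_nat n * \<tau>))))"
proof -
  have sub: "S \<subseteq> {1..n}"
    using assms(2) by (simp add: symmetric_reps_def)
  then have fin: "finite S"
    by (rule finite_subset) auto
  have normq: "norm q < 1"
    using assms by simp
  have nz: "1 + q ^ m \<noteq> 0" for m
    using one_minus_power_nonzero(2)[OF normq] by (cases m) auto
  define z where "z = exp (2 * pi * \<i> * \<sigma>)"
  define \<rho> where "\<rho> = (\<lambda>l. theta (alpha n l) (of_nat n * \<tau>) \<sigma> / theta0 (alpha n l) (of_nat n * \<tau>))"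
  define h where "h = (\<lambda>m. 1 + x\<^sup>2 * (q ^ m / (1 + q ^ m)\<^sup>2))"
  define T where "T = S - {n}"
  define g where "g = (\<lambda>l N. \<Prod>k<N. (1 + z * q ^ (n * k + l)) * (1 + q ^ (n * k + (n - l)) / z) /
                ((1 + q ^ (n * k + l)) * (1 + q ^ (n * k + (n - l)))))"
  have z0: "z \<noteq> 0" by (simp add: z_def)
  have zhalf: "z = (exp (pi * \<i> * \<sigma>))\<^sup>2"
    by (simp add: z_def exp_double[symmetric] mult_ac)
  have xsq: "x\<^sup>2 = z - 2 + 1 / z"
    unfolding assms(5) xvar_def zhalf by (simp add: exp_minus power2_eq_square field_simps)
  have h: "h m = (1 + z * q ^ m) * (1 + q ^ m / z) / ((1 + q ^ m) * (1 + q ^ m))" for m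
    unfolding h_def using z0 nz xsq by (rule Lambert_factor)
  have glim: "g l \<longlonglongrightarrow> exp (- (2 * pi * \<i> * of_rat (alpha n l) * \<sigma>)) * \<rho> l" if "l \<in> S" for l
    unfolding g_def \<rho>_def using theta_ratio_limit[OF assms(1) _ assms(3,4) z_def] that sub by auto
  \<comment> \<open>Reindexing by the reflection turns the exponents with \<open>n - l\<close> into
    those with \<open>l\<close>. The equality is exact for every \<open>N\<close>, before any
    limit.\<close>
  have gT: "(\<Prod>l\<in>T. g l N) = (\<Prod>l\<in>T. \<Prod>k<N. h (n * k + l))" for N
  proof -
    let ?a = "\<lambda>y l. \<Prod>k<N. 1 + y * q ^ (n * k + l)"
    have split: "g l N = ?a z l * ?a (1 / z) (n - l) / (?a 1 l * ?a 1 (n - l))" for l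
      by (simp add: g_def prod.distrib prod_dividef)
    have refl: "(\<Prod>l\<in>T. ?a y (n - l)) = (\<Prod>l\<in>T. ?a y l)" for y
      unfolding T_def by (rule prod.reindex_bij_betw[OF bij_betw_symmetric_reps_reflect[OF assms(2)]])
    show ?thesis
      unfolding split h prod_dividef prod.distrib refl by simp
  qed
  have Tlim: "(\<lambda>N. \<Prod>l\<in>T. \<Prod>k<N. h (n * k + l)) \<longlonglongrightarrow> (\<Prod>l\<in>T. \<rho> l)"
  proof -
    have "(\<lambda>N. \<Prod>l\<in>T. g l N) \<longlonglongrightarrow> (\<Prod>l\<in>T. exp (- (2 * pi * \<i> * of_rat (alpha n l) * \<sigma>)) * \<rho> l)"
      by (intro tendsto_prod glim) (auto simp: T_def)
    moreover have "(\<Prod>l\<in>T. exp (- (2 * pi * \<i> * of_rat (alpha n l) * \<sigma>))) =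
        exp (- (2 * pi * \<i> * \<sigma>) * (\<Sum>l\<in>T. of_rat (alpha n l)))"
      using fin by (simp add: T_def exp_sum[symmetric] sum_distrib_left mult_ac)
    then have "(\<Prod>l\<in>T. exp (- (2 * pi * \<i> * of_rat (alpha n l) * \<sigma>)) * \<rho> l) = (\<Prod>l\<in>T. \<rho> l)"
      using sum_alpha_symmetric_reps[OF assms(1,2)] by (simp add: prod.distrib T_def)
    ultimately show ?thesis
      by (simp only: gT)
  qed
  \<comment> \<open>For \<open>n \<in> S\<close> the limit \<open>L\<close> must not be read off from the theta quotients, since
    \<open>cos (pi * \<sigma>)\<close> may vanish.\<close>
  obtain L where L: "(\<lambda>k. B S n k q * x ^ (2 * k)) sums L"
    "\<And>c. filterlim c at_top sequentially \<Longrightarrow> (\<lambda>N. prod h ({m. 0 < m \<and> in_mod m S n} \<inter> {..c N})) \<longlonglongrightarrow> L"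
    unfolding h_def using B_sums[OF normq] by blast
  \<comment> \<open>Cutting at multiples of \<open>n\<close> truncates all residue classes at the
    same \<open>k\<close>, as in the theta products.\<close>
  have "filterlim (\<lambda>N. n * N) at_top sequentially"
    using assms(1) by (intro filterlim_subseq) (auto simp: strict_mono_def)
  from L(2)[OF this] have Llim: "(\<lambda>N. \<Prod>l\<in>S. \<Prod>k<N. h (n * k + l)) \<longlonglongrightarrow> L"
    unfolding prod_residue_classes[OF assms(1) sub] .
  show ?thesis
  proof (intro conjI impI allI)
    assume "n \<notin> S"
    then have "T = S" by (auto simp: T_def)
    with Tlim Llim have "L = (\<Prod>l\<in>S. \<rho> l)"
      using LIMSEQ_unique by blast
    with L(1) show "(\<lambda>k. B S n k q * x ^ (2 * k)) sums
             (\<Prod>l\<in>S. theta (alpha n l) (of_nat n * \<tau>) \<sigma> / theta0 (alpha n l) (of_nat n * \<tau>))"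
      by (simp add: \<rho>_def)
  next
    show "summable (\<lambda>k. B S n k q * x ^ (2 * k))"
      using L(1) by (rule sums_summable)
  next
    fix D w assume nS: "n \<in> S" and w: "sqrt_branch_on D w \<and> \<sigma> \<in> D"
    have cos: "cos (pi * \<sigma>) = exp (pi * \<i> * \<sigma>) * ((1 + 1 / z) / 2)"
      unfolding zhalf by (simp add: cos_exp_eq exp_minus power2_eq_square field_simps)
    \<comment> \<open>For \<open>l = n\<close> the second family of factors has exponents
      \<open>n * k\<close> starting at 0. Moving it on by one step trades the factor at exponent 0
      for the one at \<open>n * N\<close>.\<close>
    have shift: "(\<Prod>k<N. 1 + y * q ^ (n * k)) * (1 + y * q ^ (n * N)) =
        (1 + y) * (\<Prod>k<N. 1 + y * q ^ (n * k + n))" for N y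
      by (induction N) (simp_all add: algebra_simps)
    have g_n: "(1 + 1 / z) / 2 * (\<Prod>k<N. h (n * k + n)) = g n N * ((1 + 1 / z * q ^ (n * N)) / (1 + q ^ (n * N)))" for N
    proof -
      let ?a = "\<lambda>y. \<Prod>k<N. 1 + y * q ^ (n * k + n)"
      let ?b = "\<lambda>y. \<Prod>k<N. 1 + y * q ^ (n * k)"
      have "g n N * ((1 + 1 / z * q ^ (n * N)) / (1 + q ^ (n * N))) =
         ?a z * (?b (1 / z) * (1 + 1 / z * q ^ (n * N))) / (?a 1 * (?b 1 * (1 + 1 * q ^ (n * N))))"
        by (simp add: g_def prod.distrib prod_dividef mult.assoc)
      also have "\<dots> = (1 + 1 / z) / 2 * (\<Prod>k<N. h (n * k + n))"
        unfolding shift h by (simp add: prod.distrib prod_dividef mult_ac)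
      finally show ?thesis ..
    qed
    have q0: "(\<lambda>N. q ^ (n * N)) \<longlonglongrightarrow> 0"
      using LIMSEQ_power_zero[of "q ^ n"] normq assms(1)
      by (simp add: power_mult norm_power power_less_one_iff)
    \<comment> \<open>The boundary factor tends to 1 because \<open>q ^ (n * N)\<close> tends to 0.
      Since \<open>alpha n n\<close> is 1/2, the factor z^(1/2) taken out of the cosine cancels the
      remaining power of \<open>z\<close>.\<close>
    have "(\<lambda>N. exp (pi * \<i> * \<sigma>) * (g n N * ((1 + 1 / z * q ^ (n * N)) / (1 + q ^ (n * N))))) \<longlonglongrightarrow>
        exp (pi * \<i> * \<sigma>) * ((exp (- (2 * pi * \<i> * of_rat (alpha n n) * \<sigma>)) * \<rho> n) * ((1 + 1 / z * 0) / (1 + 0)))"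
      by (intro tendsto_mult tendsto_const glim[OF nS] tendsto_divide tendsto_add q0) simp
    moreover have "of_rat (alpha n n) = (1 / 2 :: complex)"
      using assms(1) by (simp add: alpha_def of_rat_divide)
    ultimately have "(\<lambda>N. cos (pi * \<sigma>) * (\<Prod>k<N. h (n * k + n))) \<longlonglongrightarrow> \<rho> n"
      unfolding cos g_n[symmetric] by (simp add: exp_minus field_simps)
    from tendsto_mult[OF this Tlim]
    have "(\<lambda>N. cos (pi * \<sigma>) * (\<Prod>l\<in>S. \<Prod>k<N. h (n * k + l))) \<longlonglongrightarrow> (\<Prod>l\<in>S. \<rho> l)"
      unfolding T_def by (simp add: prod.remove[OF fin nS] mult_ac)
    with tendsto_mult_left[OF Llim, of "cos (pi * \<sigma>)"] have "cos (pi * \<sigma>) * L = (\<Prod>l\<in>S. \<rho> l)"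
      using LIMSEQ_unique by blast
    then show "w \<sigma> * (\<Sum>k. B S n k q * x ^ (2 * k)) =
               (\<Prod>l\<in>S. theta (alpha n l) (of_nat n * \<tau>) \<sigma>) /
               (\<Prod>l\<in>S. theta0 (alpha n l) (of_nat n * \<tau>))"
      using sqrt_branch_on_unique[of D w \<sigma>] w sums_unique[OF L(1)]
      by (simp add: \<rho>_def prod_dividef)
  qed
qed

end
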